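(* Let $\Delta\ge 3$, $c\in[0,\Delta-2]$ and $\kappa=\Delta+c$. There exists $n_0=n_0(\Delta,c)$ such that for every deterministic algorithm $ALG$ that maintains a proper $\kappa$-edge-coloring of a fully dynamic forest of maximum degree at most $\Delta$, every $n\ge n_0$, and every $\epsilon>0$, there is an update sequence (starting from the empty forest) on an $n$-vertex forest such that the amortized recourse of $ALG$ on this sequence is greater than $1/2-\epsilon$. Moreover, the amortized recourse is already $\Omega(1)$ after $O(n_0)$ updates.
   Context: A dynamic forest on a fixed vertex set of $n$ vertices starts with no edges; in the fully dynamic model each update either inserts an edge joining two distinct trees or deletes an existing edge, and the maximum degree always stays at most $\Delta$ (known in advance). An algorithm must maintain after every update a proper edge coloring with palette $[\kappa]$. The recourse of an update is the number of previously colored edges whose color is changed (coloring a newly inserted edge does not count). The amortized recourse of a sequence is the total recourse divided by the number of updates. *)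

theory Defs
  imports Complex_Main
begin

text \<open>The vertex set is \<open>{..<n}\<close>. An edge is a two-element set of vertices.\<close>

type_synonym edge = "nat set"

definition degree :: "edge set \<Rightarrow> nat \<Rightarrow> nat" where
  "degree E v = card {e \<in> E. v \<in> e}"

definition same_tree :: "edge set \<Rightarrow> nat \<Rightarrow> nat \<Rightarrow> bool" where
  "same_tree E u v \<longleftrightarrow> (u, v) \<in> {(x, y). {x, y} \<in> E}\<^sup>*"

definition proper_edge_coloring :: "nat \<Rightarrow> edge set \<Rightarrow> (edge \<Rightarrow> nat) \<Rightarrow> bool" where
  "proper_edge_coloring \<kappa> E col \<longleftrightarrow>
     (\<forall>e\<in>E. col e \<in> {1..\<kappa>}) \<and>
     (\<forall>e\<in>E. \<forall>f\<in>E. e \<noteq> f \<and> e \<inter> f \<noteq> {} \<longrightarrow> col e \<noteq> col f)"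

datatype update = Insert edge | Delete edge

fun apply_update :: "update \<Rightarrow> edge set \<Rightarrow> edge set" where
  "apply_update (Insert e) E = insert e E"
| "apply_update (Delete e) E = E - {e}"

text \<open>The endpoints of an inserted edge are automatically distinct, since \<open>same_tree\<close> is reflexive.
  Deletions cannot violate the degree bound.\<close>

fun valid_update :: "nat \<Rightarrow> nat \<Rightarrow> edge set \<Rightarrow> update \<Rightarrow> bool" where
  "valid_update n \<Delta> E (Insert e) \<longleftrightarrow>
     (\<exists>u<n. \<exists>v<n. e = {u, v} \<and> \<not> same_tree E u v) \<and>
     (\<forall>x<n. degree (insert e E) x \<le> \<Delta>)"
| "valid_update n \<Delta> E (Delete e) \<longleftrightarrow> e \<in> E"

definition edges_after :: "update list \<Rightarrow> edge set" where
  "edges_after us = fold apply_update us {}"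

text \<open>Acyclicity needs no separate requirement: the initial graph is edgeless, and every
  insertion joins two distinct trees.\<close>

definition update_sequence :: "nat \<Rightarrow> nat \<Rightarrow> update list \<Rightarrow> bool" where
  "update_sequence n \<Delta> us \<longleftrightarrow>
     (\<forall>i<length us. valid_update n \<Delta> (edges_after (take i us)) (us ! i))"

text \<open>A deterministic online algorithm is identified with the function that maps the number of
  vertices and the updates received so far to its current coloring. Only the values on edges of the
  current forest are meaningful.\<close>

type_synonym algorithm = "nat \<Rightarrow> update list \<Rightarrow> edge \<Rightarrow> nat"

definition maintains_coloring :: "nat \<Rightarrow> nat \<Rightarrow> algorithm \<Rightarrow> bool" where
  "maintains_coloring \<Delta> \<kappa> ALG \<longleftrightarrow>
     (\<forall>n us. update_sequence n \<Delta> us \<longrightarrow>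
        proper_edge_coloring \<kappa> (edges_after us) (ALG n us))"

text \<open>Recourse of the update \<open>us ! i\<close>. Intersecting the edge sets before and after the update
  leaves out the inserted or deleted edge itself.\<close>

definition recourse :: "algorithm \<Rightarrow> nat \<Rightarrow> update list \<Rightarrow> nat \<Rightarrow> nat" where
  "recourse ALG n us i =
     card {e \<in> edges_after (take i us) \<inter> edges_after (take (Suc i) us).
             ALG n (take i us) e \<noteq> ALG n (take (Suc i) us) e}"

definition amortized_recourse :: "algorithm \<Rightarrow> nat \<Rightarrow> update list \<Rightarrow> real" where
  "amortized_recourse ALG n us = real (\<Sum>i<length us. recourse ALG n us i) / real (length us)"

end

theory Submission
  imports Defs "HOL-Library.Nat_Bijection"
begin

text \<open>The adversary keeps many stars with \<open>\<Delta> - 1\<close> leaves and one hub \<open>h\<close> for every set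
  \<open>A\<close> of colors; hub \<open>h\<close> strives to see all colors outside \<open>A\<close>. By pigeonhole some star is not
  attached to any hub; the adversary attaches it to the hub of the set \<open>A\<close> of its colors, after
  first deleting, if that hub is full, a hub edge with a color in \<open>A\<close> (which exists because
  \<open>\<kappa> - (\<Delta> - 1) < \<Delta>\<close>). Let the deficit be the total number of colors missing at the hubs. A
  deletion with recourse \<open>r\<close> raises it by at most \<open>r\<close>, and an insertion by at most \<open>r - 1\<close>. As
  the deficit is bounded and never negative, the total recourse is at least the number of
  insertions up to an additive constant, and at least half of all updates are insertions.\<close>

section \<open>Update sequences, recourse, trees and degrees\<close>

lemma edges_after_Nil [simp]: "edges_after [] = {}"
  by (simp add: edges_after_def)

lemma edges_after_snoc [simp]: "edges_after (us @ [u]) = apply_update u (edges_after us)"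
  by (simp add: edges_after_def)

lemma update_sequence_Nil [simp]: "update_sequence n \<Delta> []"
  by (simp add: update_sequence_def)

lemma update_sequence_snoc [simp]:
  "update_sequence n \<Delta> (us @ [u]) \<longleftrightarrow>
     update_sequence n \<Delta> us \<and> valid_update n \<Delta> (edges_after us) u"
  by (auto simp: update_sequence_def nth_append less_Suc_eq)

definition total_recourse :: "algorithm \<Rightarrow> nat \<Rightarrow> update list \<Rightarrow> nat" where
  "total_recourse ALG n us = (\<Sum>i<length us. recourse ALG n us i)"

definition recolored :: "edge set \<Rightarrow> (edge \<Rightarrow> nat) \<Rightarrow> (edge \<Rightarrow> nat) \<Rightarrow> edge set" where
  "recolored E col col' = {e \<in> E. col e \<noteq> col' e}"

lemma total_recourse_snoc:
  "total_recourse ALG n (us @ [u]) = total_recourse ALG n us +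
     card (recolored (edges_after us \<inter> edges_after (us @ [u])) (ALG n us) (ALG n (us @ [u])))"
proof -
  have "recourse ALG n (us @ [u]) i = recourse ALG n us i" if "i < length us" for i
    using that by (simp add: recourse_def)
  then show ?thesis
    by (simp add: total_recourse_def recourse_def recolored_def)
qed

text \<open>No edge leaves \<open>V\<close>, so a path followed backwards from \<open>v\<close>
  stays in \<open>V\<close> and never reaches \<open>u\<close>.\<close>

lemma closed_not_same_tree:
  assumes "\<And>e. e \<in> E \<Longrightarrow> e \<inter> V \<noteq> {} \<Longrightarrow> e \<subseteq> V" and "v \<in> V" and "u \<notin> V"
  shows "\<not> same_tree E u v"
proof
  assume "same_tree E u v"
  then have "(u, v) \<in> {(x, y). {x, y} \<in> E}\<^sup>*"
    by (simp add: same_tree_def)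
  then have "u \<in> V"
    by (induction rule: converse_rtrancl_induct) (use assms in blast)+
  with \<open>u \<notin> V\<close> show False by simp
qed

text \<open>Any two edges at \<open>v\<close> meet there, so their colors differ.\<close>

lemma card_proper_colors:
  assumes "proper_edge_coloring \<kappa> E col"
  shows "card (col ` {e \<in> E. v \<in> e}) = degree E v"
proof -
  have "inj_on col {e \<in> E. v \<in> e}"
    using assms unfolding proper_edge_coloring_def inj_on_def by blast
  then show ?thesis
    by (simp add: card_image degree_def)
qed

lemma degree_mono: "E \<subseteq> F \<Longrightarrow> finite F \<Longrightarrow> degree E v \<le> degree F v"
  unfolding degree_def by (intro card_mono) auto

lemma degree_insert:
  "finite E \<Longrightarrow> e \<notin> E \<Longrightarrow> degree (insert e E) v = degree E v + of_bool (v \<in> e)"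
proof -
  assume "finite E" "e \<notin> E"
  moreover have "{f \<in> insert e E. v \<in> f} =
      (if v \<in> e then insert e {f \<in> E. v \<in> f} else {f \<in> E. v \<in> f})"
    by auto
  ultimately show ?thesis
    by (simp add: degree_def)
qed

section \<open>Hubs, stars and spokes\<close>

locale adversary =
  fixes \<Delta> \<kappa> :: nat
  assumes \<Delta>_pos: "2 \<le> \<Delta>" and \<kappa>_le: "\<kappa> \<le> 2 * \<Delta> - 2"
begin

text \<open>\<open>set_encode\<close> sums \<open>2 ^ q\<close> over the elements of a set; colors
  are at most \<open>\<kappa>\<close>, so the codes of all color sets lie below this power. The
  vertices below it are the hubs.\<close>

definition hubs :: nat where "hubs = 2 ^ (\<kappa> + 1)"

text \<open>One more than the number of spokes that hubs of degree at most \<open>\<Delta>\<close>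
  can carry together.\<close>

definition star_count :: nat where "star_count = hubs * \<Delta> + 1"

text \<open>Each star owns a block of \<open>\<Delta>\<close> consecutive vertices behind the hubs,
  its center first.\<close>

definition center :: "nat \<Rightarrow> nat" where "center i = hubs + i * \<Delta>"

definition star_vertices :: "nat \<Rightarrow> nat set" where
  "star_vertices i = {center i..<center i + \<Delta>}"

text \<open>With only \<open>\<Delta> - 1\<close> leaves, the center keeps one unit of degree for a
  spoke.\<close>

definition star :: "nat \<Rightarrow> edge set" where
  "star i = (\<lambda>k. {center i, center i + k}) ` {1..<\<Delta>}"

definition stars :: "edge set" where "stars = (\<Union>i<star_count. star i)"

definition spokes :: "edge set" where
  "spokes = {{h, center i} | h i. h < hubs \<and> i < star_count}"

text \<open>Hub \<open>h\<close> is responsible for the color set \<open>set_decode h\<close>; every subset of \<open>{1..\<kappa>}\<close> is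
  \<open>set_decode h\<close> for some \<open>h < hubs\<close>.\<close>

definition missing :: "edge set \<Rightarrow> (edge \<Rightarrow> nat) \<Rightarrow> nat \<Rightarrow> nat set" where
  "missing E col h = {1..\<kappa>} - set_decode h - col ` {e \<in> E. h \<in> e}"

definition deficit :: "edge set \<Rightarrow> (edge \<Rightarrow> nat) \<Rightarrow> nat" where
  "deficit E col = (\<Sum>h<hubs. card (missing E col h))"

definition configuration :: "edge set \<Rightarrow> bool" where
  "configuration E \<longleftrightarrow> stars \<subseteq> E \<and> E \<subseteq> stars \<union> spokes \<and> (\<forall>v. degree E v \<le> \<Delta>)"

lemma hub_less_center: "h < hubs \<Longrightarrow> h < center i"
  by (simp add: center_def)

text \<open>The block index can be read off a vertex as
  \<open>(v - hubs) div \<Delta>\<close>.\<close>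

lemma star_vertices_disjoint:
  assumes "v \<in> star_vertices i" "v \<in> star_vertices j"
  shows "i = j"
proof -
  have "(v - hubs) div \<Delta> = k" if "v \<in> star_vertices k" for k
  proof -
    have "k * \<Delta> \<le> v - hubs" "v - hubs < k * \<Delta> + \<Delta>"
      using that \<Delta>_pos by (auto simp: star_vertices_def center_def)
    then show ?thesis
      by (simp add: div_nat_eqI add.commute mult.commute)
  qed
  with assms show ?thesis by blast
qed

lemma center_in_star_vertices: "center i \<in> star_vertices i"
  using \<Delta>_pos by (simp add: star_vertices_def)

lemma center_inj: "center i = center j \<longleftrightarrow> i = j"
  using \<Delta>_pos by (simp add: center_def)

lemma star_edge_subset: "e \<in> star i \<Longrightarrow> e \<subseteq> star_vertices i"
  using \<Delta>_pos by (auto simp: star_def star_vertices_def)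

lemma star_edge_no_hub: "e \<in> stars \<Longrightarrow> h < hubs \<Longrightarrow> h \<notin> e"
  by (auto simp: stars_def star_def center_def)

lemma finite_star [simp]: "finite (star i)"
  by (simp add: star_def)

lemma finite_stars [simp]: "finite stars"
  by (simp add: stars_def)

lemma finite_spokes [simp]: "finite spokes"
proof -
  have "spokes = (\<lambda>(h, i). {h, center i}) ` ({..<hubs} \<times> {..<star_count})"
    by (auto simp: spokes_def)
  then show ?thesis by simp
qed

lemma card_star: "card (star i) = \<Delta> - 1"
proof -
  have "inj_on (\<lambda>k. {center i, center i + k}) {1..<\<Delta>}"
    by (auto simp: inj_on_def doubleton_eq_iff)
  then show ?thesis
    by (simp add: star_def card_image)
qed

lemma finite_configuration: "configuration E \<Longrightarrow> finite E"
  unfolding configuration_def by (meson finite_UnI finite_spokes finite_stars finite_subset)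

text \<open>The blocks are disjoint, so all star edges at \<open>v\<close> belong to a single
  star.\<close>

lemma degree_stars_le: "degree stars v \<le> \<Delta>"
proof (cases "\<exists>i. v \<in> star_vertices i")
  case True
  then obtain i where "v \<in> star_vertices i" by blast
  then have "{e \<in> stars. v \<in> e} \<subseteq> star i"
    using star_edge_subset star_vertices_disjoint unfolding stars_def by blast
  then have "degree stars v \<le> card (star i)"
    unfolding degree_def by (intro card_mono) auto
  then show ?thesis by (simp add: card_star)
next
  case False
  then have "{e \<in> stars. v \<in> e} = {}"
    using star_edge_subset unfolding stars_def by blast
  then show ?thesis by (simp only: degree_def card.empty)
qed

lemma configuration_stars: "configuration stars"
  by (simp add: configuration_def degree_stars_le)

section \<open>Change of the deficit under one update\<close>

lemma missing_subset:
  assumes "\<And>e. e \<in> E - E' \<Longrightarrow> h \<in> e \<Longrightarrow> col e \<in> set_decode h"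
  shows "missing E' col' h \<subseteq>
    missing E col h \<union> col ` {e \<in> recolored (E \<inter> E') col col'. h \<in> e}"
proof
  fix q assume q: "q \<in> missing E' col' h"
  show "q \<in> missing E col h \<union> col ` {e \<in> recolored (E \<inter> E') col col'. h \<in> e}"
  proof (cases "q \<in> missing E col h")
    \<comment> \<open>Color \<open>q\<close> was seen at \<open>h\<close> on some edge
      \<open>f\<close>. Vanished edges at \<open>h\<close> had colors in
      \<open>set_decode h\<close>, so \<open>f\<close> survives; as \<open>q\<close> is missing now,
      \<open>f\<close> was recolored.\<close>
    case False
    then obtain f where f: "f \<in> E" "h \<in> f" "q = col f"
      using q by (auto simp: missing_def)
    then have "f \<in> E'"
      using q assms by (auto simp: missing_def)
    moreover from this have "col' f \<noteq> q"
      using q f by (auto simp: missing_def image_iff)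
    ultimately show ?thesis
      using f by (auto simp: recolored_def)
  qed simp
qed

lemma finite_missing [simp]: "finite (missing E col h)"
  by (simp add: missing_def)

lemma card_missing_le:
  assumes "\<And>e. e \<in> E - E' \<Longrightarrow> h \<in> e \<Longrightarrow> col e \<in> set_decode h" and "finite E"
  shows "card (missing E' col' h) \<le>
    card (missing E col h) + card {e \<in> recolored (E \<inter> E') col col'. h \<in> e}"
proof -
  let ?R = "{e \<in> recolored (E \<inter> E') col col'. h \<in> e}"
  have fin: "finite ?R"
    using \<open>finite E\<close> by (simp add: recolored_def)
  have "card (missing E' col' h) \<le> card (missing E col h \<union> col ` ?R)"
    using missing_subset[OF assms(1)] fin by (intro card_mono) auto
  also have "\<dots> \<le> card (missing E col h) + card (col ` ?R)"
    by (rule card_Un_le)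
  also have "\<dots> \<le> card (missing E col h) + card ?R"
    using fin card_image_le by (intro add_left_mono) blast
  finally show ?thesis .
qed

text \<open>A spoke contains exactly one hub and a star edge none, so nothing is counted twice.
  Leaving out \<open>stars\<close> on the right is what makes the recoloring of a star edge a wasted
  unit of recourse.\<close>

lemma sum_card_hub_le:
  assumes "R \<subseteq> stars \<union> spokes"
  shows "(\<Sum>h<hubs. card {e \<in> R. h \<in> e}) \<le> card (R - stars)"
proof -
  have fin: "finite R"
    using assms by (rule finite_subset) simp
  have "g = h" if "e \<in> R" "g \<in> e" "h \<in> e" "g < hubs" "h < hubs" for e g h
    using that assms star_edge_no_hub by (fastforce simp: spokes_def center_def)
  then have "(\<Sum>h<hubs. card {e \<in> R. h \<in> e}) = card (\<Union>h<hubs. {e \<in> R. h \<in> e})"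
    using fin by (intro card_UN_disjoint[symmetric]) auto
  also have "\<dots> \<le> card (R - stars)"
    using fin star_edge_no_hub by (intro card_mono) auto
  finally show ?thesis .
qed

text \<open>The color of the deleted edge is not one that hub \<open>h\<close> strives for, so only
  recoloring can raise the deficit.\<close>

lemma deficit_delete:
  assumes E: "configuration E" and h: "h < hubs" "h \<in> e" "e \<in> E" and "col e \<in> set_decode h"
  shows "deficit (E - {e}) col' \<le> deficit E col + card (recolored (E \<inter> (E - {e})) col col')"
proof -
  let ?R = "recolored (E \<inter> (E - {e})) col col'"
  have e: "e \<in> spokes"
    using E h star_edge_no_hub by (auto simp: configuration_def)
  have RE: "?R \<subseteq> stars \<union> spokes"
    using E by (auto simp: recolored_def configuration_def)
  then have "finite ?R"
    by (rule finite_subset) simp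
  have "card (missing (E - {e}) col' g) \<le> card (missing E col g) + card {f \<in> ?R. g \<in> f}"
    if "g < hubs" for g
  proof (rule card_missing_le[OF _ finite_configuration[OF E]])
    fix f assume "f \<in> E - (E - {e})" "g \<in> f"
    \<comment> \<open>A spoke has just one hub, so only \<open>h\<close> loses an edge.\<close>
    then have "f = e" "g = h"
      using e h that by (auto simp: spokes_def center_def)
    with assms show "col f \<in> set_decode g" by simp
  qed
  then have "deficit (E - {e}) col' \<le> deficit E col + (\<Sum>g<hubs. card {f \<in> ?R. g \<in> f})"
    unfolding deficit_def sum.distrib[symmetric] by (intro sum_mono) simp
  also have "(\<Sum>g<hubs. card {f \<in> ?R. g \<in> f}) \<le> card (?R - stars)"
    using RE by (rule sum_card_hub_le)
  also have "\<dots> \<le> card ?R"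
    using \<open>finite ?R\<close> by (simp add: card_mono)
  finally show ?thesis by simp
qed

text \<open>Either the star of \<open>center i\<close> is recolored, and that recoloring is wasted because it does
  not affect any hub, or the colors at \<open>center i\<close> persist and force the new edge to have a color
  that hub \<open>h\<close> was missing.\<close>

lemma deficit_insert:
  assumes E: "configuration E" and h: "h < hubs" and free: "{f \<in> E. center i \<in> f} = star i"
    and star: "star i \<subseteq> stars"
    and dec: "set_decode h = col ` star i" and new: "{h, center i} \<notin> E"
    and proper: "proper_edge_coloring \<kappa> (insert {h, center i} E) col'"
  shows "deficit (insert {h, center i} E) col' + 1 \<le>
    deficit E col + card (recolored (E \<inter> insert {h, center i} E) col col')"
proof -
  define e where "e = {h, center i}"
  let ?R = "recolored (E \<inter> insert e E) col col'"
  have RE: "?R \<subseteq> stars \<union> spokes"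
    using E by (auto simp: recolored_def configuration_def)
  then have finR: "finite ?R"
    by (rule finite_subset) simp
  have le: "card (missing (insert e E) col' g) \<le> card (missing E col g) + card {f \<in> ?R. g \<in> f}" for g
    by (rule card_missing_le[OF _ finite_configuration[OF E]]) auto
  have hubR: "(\<Sum>g<hubs. card {f \<in> ?R. g \<in> f}) \<le> card (?R - stars)"
    using RE by (rule sum_card_hub_le)
  show ?thesis
  proof (cases "\<exists>f \<in> star i. f \<in> ?R")
    case True
    then have "?R - stars \<subset> ?R"
      using star by blast
    then have less: "card (?R - stars) < card ?R"
      using finR by (rule psubset_card_mono[rotated])
    have "deficit (insert e E) col' \<le> deficit E col + (\<Sum>g<hubs. card {f \<in> ?R. g \<in> f})"
      unfolding deficit_def sum.distrib[symmetric] by (intro sum_mono) (rule le)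
    with hubR less show ?thesis
      by (simp add: e_def)
  next
    case False
    \<comment> \<open>\<open>?M\<close> bounds the colors that \<open>h\<close> can miss afterwards.
      The color of the new edge lies in \<open>?M\<close>, but \<open>h\<close> sees it now, which
      makes the bound strict.\<close>
    let ?M = "missing E col h \<union> col ` {f \<in> ?R. h \<in> f}"
    have ne: "col' e \<noteq> col' f" if "f \<in> E" "f \<inter> e \<noteq> {}" for f
      using proper that new unfolding proper_edge_coloring_def e_def by (metis inf_commute insertCI)
    have "col' f = col f" if "f \<in> star i" for f
      using that False free by (auto simp: recolored_def)
    moreover have "f \<in> E" "f \<inter> e \<noteq> {}" if "f \<in> star i" for f
      using that free unfolding e_def by blast+
    ultimately have "col' e \<notin> set_decode h"
      using ne unfolding dec by (metis imageE)
    moreover have "col' e \<in> {1..\<kappa>}"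
      using proper unfolding proper_edge_coloring_def e_def by blast
    \<comment> \<open>If the new edge takes the former color of an edge \<open>f\<close> at
      \<open>h\<close>, then \<open>f\<close> was recolored, so this color still lies in
      \<open>?M\<close>.\<close>
    moreover have "f \<in> ?R" if "f \<in> E" "h \<in> f" "col' e = col f" for f
      using ne[of f] that by (auto simp: recolored_def e_def)
    ultimately have "col' e \<in> ?M"
      by (auto simp: missing_def)
    moreover have "col' e \<notin> missing (insert e E) col' h"
      by (auto simp: missing_def e_def)
    moreover have "missing (insert e E) col' h \<subseteq> ?M"
      by (rule missing_subset) auto
    ultimately have "missing (insert e E) col' h \<subset> ?M"
      by blast
    then have "card (missing (insert e E) col' h) < card ?M"
      using finR by (intro psubset_card_mono) auto
    also have "\<dots> \<le> card (missing E col h) + card (col ` {f \<in> ?R. h \<in> f})"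
      by (rule card_Un_le)
    also have "\<dots> \<le> card (missing E col h) + card {f \<in> ?R. h \<in> f}"
      using finR by (intro add_left_mono card_image_le) simp
    finally have "deficit (insert e E) col' < (\<Sum>g<hubs. card (missing E col g) + card {f \<in> ?R. g \<in> f})"
      unfolding deficit_def using h le by (intro sum_strict_mono_ex1) auto
    also have "\<dots> = deficit E col + (\<Sum>g<hubs. card {f \<in> ?R. g \<in> f})"
      by (simp add: deficit_def sum.distrib)
    also have "\<dots> \<le> deficit E col + card ?R"
      using hubR card_mono[OF finR, of "?R - stars"] by auto
    finally show ?thesis
      by (simp add: e_def)
  qed
qed

section \<open>Free stars and the legality of moves\<close>

lemma ex_free_star:
  assumes E: "configuration E"
  obtains i where "i < star_count" "{f \<in> E. center i \<in> f} = star i"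
proof -
  have finE: "finite E"
    using E by (rule finite_configuration)
  define used where "used = {i. i < star_count \<and> (\<exists>e \<in> E - stars. center i \<in> e)}"
  have spoke: "\<exists>h i. h < hubs \<and> e = {h, center i}" if "e \<in> E - stars" for e
    using that E unfolding configuration_def spokes_def by blast
  \<comment> \<open>Every edge outside \<open>stars\<close> uses one of the at most
    \<open>hubs * \<Delta>\<close> degree units of the hubs.\<close>
  have "E - stars \<subseteq> (\<Union>h<hubs. {e \<in> E. h \<in> e})"
    using spoke by blast
  then have "card (E - stars) \<le> card (\<Union>h<hubs. {e \<in> E. h \<in> e})"
    using finE by (intro card_mono) auto
  also have "\<dots> \<le> (\<Sum>h<hubs. degree E h)"
    unfolding degree_def by (rule card_UN_le) simp
  also have "\<dots> \<le> hubs * \<Delta>"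
    using sum_bounded_above[of "{..<hubs}" "degree E" \<Delta>] E by (simp add: configuration_def)
  finally have small: "card (E - stars) \<le> hubs * \<Delta>" .
  have "\<forall>i \<in> used. \<exists>e \<in> E - stars. center i \<in> e"
    by (auto simp: used_def)
  then obtain s where s: "\<And>i. i \<in> used \<Longrightarrow> s i \<in> E - stars \<and> center i \<in> s i"
    by metis
  \<comment> \<open>A spoke has only one center, so different occupied stars get different
    spokes.\<close>
  have "inj_on s used"
  proof (rule inj_onI)
    fix i j assume ij: "i \<in> used" "j \<in> used" "s i = s j"
    obtain h k where hk: "h < hubs" "s i = {h, center k}"
      using s[OF ij(1)] spoke by blast
    have "center i = center k" "center j = center k"
      using s[OF ij(1)] s[OF ij(2)] ij(3) hk hub_less_center[of h] by (metis insertE less_irrefl singletonD)+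
    then show "i = j" by (simp add: center_inj)
  qed
  moreover have "s ` used \<subseteq> E - stars"
    using s by auto
  ultimately have "card used \<le> card (E - stars)"
    using finE by (metis card_inj_on_le finite_Diff)
  with small have "card used < card {..<star_count}"
    by (simp add: star_count_def)
  moreover have "used \<subseteq> {..<star_count}"
    by (auto simp: used_def)
  ultimately have "used \<noteq> {..<star_count}" by auto
  then obtain i where i: "i < star_count" "i \<notin> used"
    using \<open>used \<subseteq> {..<star_count}\<close> by blast
  have "{f \<in> E. center i \<in> f} = star i"
  proof
    show "star i \<subseteq> {f \<in> E. center i \<in> f}"
      using i E by (auto simp: configuration_def stars_def star_def)
    show "{f \<in> E. center i \<in> f} \<subseteq> star i"
    proof
      fix f assume f: "f \<in> {f \<in> E. center i \<in> f}"
      then have "f \<in> stars"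
        using i by (auto simp: used_def)
      then obtain j where j: "f \<in> star j"
        by (auto simp: stars_def)
      then have "center i \<in> star_vertices j"
        using star_edge_subset f by blast
      then have "j = i"
        using star_vertices_disjoint center_in_star_vertices by blast
      with j show "f \<in> star i" by simp
    qed
  qed
  with i that show thesis by blast
qed

text \<open>A spoke can meet a block only in its center, and \<open>center i\<close> has only star
  edges; hence no edge leaves block \<open>i\<close>.\<close>

lemma free_star_not_same_tree:
  assumes "configuration E" "{f \<in> E. center i \<in> f} = star i" "h < hubs"
  shows "\<not> same_tree E h (center i)"
proof (rule closed_not_same_tree)
  show "center i \<in> star_vertices i"
    by (rule center_in_star_vertices)
  show "h \<notin> star_vertices i"
    using hub_less_center[OF assms(3), of i] by (simp add: star_vertices_def)
  fix e assume e: "e \<in> E" "e \<inter> star_vertices i \<noteq> {}"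
  have "e \<in> star i"
  proof (cases "e \<in> stars")
    case True
    then obtain j where j: "e \<in> star j"
      by (auto simp: stars_def)
    then have "j = i"
      using e star_edge_subset star_vertices_disjoint by blast
    with j show ?thesis by simp
  next
    case False
    then obtain g j where gj: "g < hubs" "e = {g, center j}"
      using e assms(1) unfolding configuration_def spokes_def by blast
    then have "g \<notin> star_vertices i"
      using hub_less_center[of g i] by (simp add: star_vertices_def)
    then have "center j \<in> star_vertices i"
      using e gj by auto
    then have "j = i"
      using star_vertices_disjoint center_in_star_vertices by blast
    then show ?thesis
      using e gj assms(2) by blast
  qed
  then show "e \<subseteq> star_vertices i"
    by (rule star_edge_subset)
qed

lemma configuration_insert:
  assumes E: "configuration E" and "i < star_count" "{f \<in> E. center i \<in> f} = star i"
    and "h < hubs" "degree E h < \<Delta>" and new: "{h, center i} \<notin> E"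
  shows "configuration (insert {h, center i} E)"
proof -
  have "degree E (center i) < \<Delta>"
    using assms(3) card_star \<Delta>_pos by (simp add: degree_def)
  then have "degree (insert {h, center i} E) v \<le> \<Delta>" for v
    using assms finite_configuration[OF E] by (auto simp: degree_insert configuration_def)
  then show ?thesis
    using assms by (auto simp: configuration_def spokes_def)
qed

lemma configuration_delete:
  assumes E: "configuration E" and "h < hubs" "h \<in> e"
  shows "configuration (E - {e})"
proof -
  have "degree (E - {e}) v \<le> \<Delta>" for v
    using degree_mono[of "E - {e}" E v] finite_configuration[OF E] E
    by (meson Diff_subset configuration_def order_trans)
  then show ?thesis
    using assms star_edge_no_hub by (auto simp: configuration_def)
qed

section \<open>Building the stars from the empty forest\<close>

definition vertex_bound :: nat where "vertex_bound = hubs + star_count * \<Delta>"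

lemma center_less:
  assumes "i < star_count"
  shows "center i + \<Delta> \<le> vertex_bound"
proof -
  have "Suc i * \<Delta> \<le> star_count * \<Delta>"
    using assms by (intro mult_le_mono1) simp
  then show ?thesis by (simp add: center_def vertex_bound_def)
qed

text \<open>The edges can come in any order, since every leaf is isolated until its own edge
  arrives. The exact length enters \<open>overhead\<close>.\<close>

lemma ex_stars_sequence:
  assumes "vertex_bound \<le> n"
  shows "\<exists>us. update_sequence n \<Delta> us \<and> edges_after us = stars \<and>
    length us = star_count * (\<Delta> - 1)"
proof -
  define edge_of where "edge_of = (\<lambda>(i, k). {center i, center i + k})"
  \<comment> \<open>\<open>F\<close> holds the (star, leaf) index pairs whose edges are already
    present.\<close>
  have "\<exists>us. update_sequence n \<Delta> us \<and> edges_after us = edge_of ` F \<and> length us = card F"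
    if "finite F" "F \<subseteq> {..<star_count} \<times> {1..<\<Delta>}" for F
    using that
  proof (induction F rule: finite_induct)
    case empty
    show ?case
      by (rule exI[of _ "[]"]) simp
  next
    case (insert p F)
    then obtain us where us: "update_sequence n \<Delta> us" "edges_after us = edge_of ` F" "length us = card F"
      by auto
    obtain i k where p: "p = (i, k)" by force
    with insert.prems have ik: "i < star_count" "1 \<le> k" "k < \<Delta>" by auto
    \<comment> \<open>An edge at this vertex belongs to star \<open>i\<close>; since
      \<open>k \<ge> 1\<close> the vertex is not the center, so the edge would come from the pair
      \<open>(i, k)\<close>.\<close>
    have leaf: "center i + k \<notin> e" if e: "e \<in> edge_of ` F" for e
    proof
      assume v: "center i + k \<in> e"
      obtain j l where jl: "(j, l) \<in> F" "e = {center j, center j + l}"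
        using e unfolding edge_of_def by (metis (no_types, lifting) case_prod_conv imageE surj_pair)
      then have "l < \<Delta>" "center i + k \<in> star_vertices j"
        using insert.prems v by (auto simp: star_vertices_def)
      moreover have "center i + k \<in> star_vertices i"
        using ik by (simp add: star_vertices_def)
      ultimately have "i = j"
        using star_vertices_disjoint by blast
      then have "(i, k) \<in> F"
        using v jl ik by auto
      with p insert.hyps show False by simp
    qed
    have "\<not> same_tree (edge_of ` F) (center i) (center i + k)"
      using leaf ik by (intro closed_not_same_tree[where V = "{center i + k}"]) auto
    moreover have "center i < n" "center i + k < n"
      using center_less[OF ik(1)] ik assms by auto
    moreover have "insert (edge_of p) (edge_of ` F) \<subseteq> stars"
      using insert.prems by (auto simp: stars_def star_def edge_of_def)
    then have "degree (insert (edge_of p) (edge_of ` F)) v \<le> \<Delta>" for v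
      by (rule order_trans[OF degree_mono[OF _ finite_stars] degree_stars_le])
    ultimately have "valid_update n \<Delta> (edge_of ` F) (Insert (edge_of p))"
      unfolding p edge_of_def valid_update.simps prod.case by blast
    with us insert.hyps show ?case
      by (intro exI[of _ "us @ [Insert (edge_of p)]"]) simp
  qed
  from this[of "{..<star_count} \<times> {1..<\<Delta>}"] obtain us where
    "update_sequence n \<Delta> us" "edges_after us = edge_of ` ({..<star_count} \<times> {1..<\<Delta>})"
    "length us = star_count * (\<Delta> - 1)"
    by auto
  moreover have "edge_of ` ({..<star_count} \<times> {1..<\<Delta>}) = stars"
    unfolding stars_def star_def edge_of_def by auto
  ultimately show ?thesis by auto
qed

text \<open>Since \<open>length us + card (edges_after us)\<close> is twice the number of insertions, the inequality
  bounds insertions plus deficit by the recourse, up to a constant.\<close>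

definition invariant :: "algorithm \<Rightarrow> nat \<Rightarrow> nat \<Rightarrow> update list \<Rightarrow> bool" where
  "invariant ALG n s us \<longleftrightarrow> update_sequence n \<Delta> us \<and> configuration (edges_after us) \<and>
     length us + card (edges_after us) + 2 * deficit (edges_after us) (ALG n us)
       \<le> 2 * total_recourse ALG n us + s"

section \<open>The moves of the adversary\<close>

lemma invariant_step:
  assumes ALG: "maintains_coloring \<Delta> \<kappa> ALG" and n: "vertex_bound \<le> n"
    and inv: "invariant ALG n s us"
  shows "\<exists>u. invariant ALG n s (us @ [u])"
proof -
  define E where "E = edges_after us"
  define col where "col = ALG n us"
  have us: "update_sequence n \<Delta> us" and E: "configuration E"
    and bound: "length us + card E + 2 * deficit E col \<le> 2 * total_recourse ALG n us + s"
    using inv by (auto simp: invariant_def E_def col_def)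
  have finE: "finite E"
    using E by (rule finite_configuration)
  have proper: "proper_edge_coloring \<kappa> E col"
    using ALG us by (simp add: maintains_coloring_def E_def col_def)
  obtain i where i: "i < star_count" "{f \<in> E. center i \<in> f} = star i"
    using ex_free_star[OF E] by blast
  \<comment> \<open>Hub \<open>h\<close> strives for exactly the colors outside those of the star,
    so if the star keeps its colors, a new spoke gets a color that \<open>h\<close> wants.\<close>
  define h where "h = set_encode (col ` star i)"
  have dec: "set_decode h = col ` star i"
    by (simp add: h_def)
  have sub: "col ` star i \<subseteq> {1..\<kappa>}"
    using proper i(2) unfolding proper_edge_coloring_def by blast
  have card_dec: "card (set_decode h) = \<Delta> - 1"
    using card_proper_colors[OF proper, of "center i"] i(2) by (simp add: dec degree_def card_star)
  \<comment> \<open>The full set \<open>{..\<kappa>}\<close> has code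
    \<open>hubs - 1\<close>.\<close>
  have "h \<le> set_encode {..\<kappa>}"
    unfolding h_def set_encode_def using sub by (simp, intro sum_mono2) auto
  also have "\<dots> < hubs"
    unfolding set_encode_def hubs_def
    by (induction \<kappa>) (auto simp: atMost_Suc)
  finally have h: "h < hubs" .
  have hn: "h < n" "center i < n"
    using h center_less[OF i(1)] n \<Delta>_pos by (auto simp: vertex_bound_def)
  \<comment> \<open>With recourse \<open>r\<close>, an insertion raises
    \<open>length us + card E\<close> by 2 and the deficit by at most \<open>r - 1\<close>; a
    deletion keeps that sum and raises the deficit by at most \<open>r\<close>. Either way the left
    side grows by at most \<open>2 * r\<close>. The star is chosen afresh each time, so an insertion
    need not directly follow a deletion.\<close>
  show ?thesis
  proof (cases "degree E h < \<Delta>")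
    case True
    let ?e = "{h, center i}" and ?u = "Insert {h, center i}"
    let ?E' = "insert ?e E" and ?col' = "ALG n (us @ [?u])"
    have new: "?e \<notin> E"
    proof
      assume "?e \<in> E"
      then have "?e \<in> star i" using i(2) by blast
      then have "?e \<in> stars" using i(1) by (auto simp: stars_def)
      then show False using star_edge_no_hub[OF _ h] by blast
    qed
    have E': "configuration ?E'"
      using configuration_insert[OF E i h True new] .
    have "valid_update n \<Delta> E ?u"
      using hn free_star_not_same_tree[OF E i(2) h] E'
      by (auto simp: configuration_def simp del: insert_iff)
    then have us': "update_sequence n \<Delta> (us @ [?u])"
      using us by (simp add: E_def)
    moreover have after: "edges_after (us @ [?u]) = ?E'"
      by (simp add: E_def)
    ultimately have "proper_edge_coloring \<kappa> ?E' ?col'"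
      using ALG unfolding maintains_coloring_def by metis
    then have "deficit ?E' ?col' + 1 \<le> deficit E col + card (recolored (E \<inter> ?E') col ?col')"
      using i h dec new E by (intro deficit_insert) (auto simp: stars_def)
    moreover have "total_recourse ALG n (us @ [?u]) =
        total_recourse ALG n us + card (recolored (E \<inter> ?E') col ?col')"
      using total_recourse_snoc[of ALG n us ?u] by (simp only: after E_def col_def)
    moreover have "card ?E' = card E + 1"
      using new finE by simp
    ultimately have "invariant ALG n s (us @ [?u])"
      using us' E' bound unfolding invariant_def after by simp
    then show ?thesis ..
  next
    case False
    \<comment> \<open>A full hub has \<open>\<Delta>\<close> edges of distinct colors, but at most
      \<open>\<Delta> - 1\<close> colors avoid \<open>set_decode h\<close>. Here
      \<open>\<kappa>_le\<close> enters.\<close>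
    have "\<exists>e \<in> E. h \<in> e \<and> col e \<in> set_decode h"
    proof (rule ccontr)
      assume "\<not> ?thesis"
      then have "col ` {e \<in> E. h \<in> e} \<subseteq> {1..\<kappa>} - set_decode h"
        using proper by (auto simp: proper_edge_coloring_def)
      then have "degree E h \<le> card ({1..\<kappa>} - set_decode h)"
        unfolding card_proper_colors[OF proper, symmetric] by (intro card_mono) auto
      also have "\<dots> = \<kappa> - (\<Delta> - 1)"
        using sub by (simp add: card_Diff_subset card_dec flip: dec)
      finally show False
        using False \<kappa>_le \<Delta>_pos by linarith
    qed
    then obtain e where e: "e \<in> E" "h \<in> e" "col e \<in> set_decode h" by blast
    let ?u = "Delete e"
    let ?E' = "E - {e}" and ?col' = "ALG n (us @ [?u])"
    have E': "configuration ?E'"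
      using configuration_delete[OF E h e(2)] .
    have us': "update_sequence n \<Delta> (us @ [?u])"
      using us e by (simp add: E_def)
    have after: "edges_after (us @ [?u]) = ?E'"
      by (simp add: E_def)
    have "deficit ?E' ?col' \<le> deficit E col + card (recolored (E \<inter> ?E') col ?col')"
      using deficit_delete[where E = E and col = col and col' = ?col', OF E h e(2,1,3)] .
    moreover have "total_recourse ALG n (us @ [?u]) =
        total_recourse ALG n us + card (recolored (E \<inter> ?E') col ?col')"
      using total_recourse_snoc[of ALG n us ?u] by (simp only: after E_def col_def)
    moreover have "card E = card ?E' + 1"
      using card.remove[OF finE e(1)] by simp
    ultimately have "invariant ALG n s (us @ [?u])"
      using us' E' bound unfolding invariant_def after by simp
    then show ?thesis ..
  qed
qed

lemma invariant_extend:
  assumes "maintains_coloring \<Delta> \<kappa> ALG" "vertex_bound \<le> n" "invariant ALG n s us"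
  shows "\<exists>ws. length ws = K \<and> invariant ALG n s (us @ ws)"
proof (induction K)
  case 0
  with assms show ?case by simp
next
  case (Suc K)
  then obtain ws where ws: "length ws = K" "invariant ALG n s (us @ ws)" by blast
  with invariant_step[OF assms(1,2)] obtain u where "invariant ALG n s ((us @ ws) @ [u])"
    by blast
  with ws show ?case
    by (intro exI[of _ "ws @ [u]"]) simp
qed

section \<open>From the invariant to amortized bounds\<close>

lemma deficit_le: "deficit E col \<le> hubs * \<kappa>"
proof -
  have "card (missing E col h) \<le> \<kappa>" for h
    using card_mono[of "{1..\<kappa>}" "missing E col h"] by (auto simp: missing_def)
  then show ?thesis
    unfolding deficit_def using sum_bounded_above[of "{..<hubs}" _ \<kappa>] by simp
qed

text \<open>Bounds the left side of the invariant once the stars are built, with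
  \<open>hubs * \<kappa>\<close> in place of the deficit; the recourse spent so far is estimated by
  0.\<close>

definition overhead :: nat where
  "overhead = star_count * (\<Delta> - 1) + card stars + 2 * (hubs * \<kappa>)"

lemma ex_sequence_of_length:
  assumes "maintains_coloring \<Delta> \<kappa> ALG" "vertex_bound \<le> n" "star_count * (\<Delta> - 1) \<le> L"
  shows "\<exists>us. length us = L \<and> invariant ALG n overhead us"
proof -
  obtain us where us: "update_sequence n \<Delta> us" "edges_after us = stars"
      "length us = star_count * (\<Delta> - 1)"
    using ex_stars_sequence[OF assms(2)] by blast
  then have "invariant ALG n overhead us"
    using deficit_le[of stars "ALG n us"] configuration_stars
    by (simp add: invariant_def overhead_def)
  from invariant_extend[OF assms(1,2) this, of "L - length us"]
  obtain ws where "length ws = L - length us" "invariant ALG n overhead (us @ ws)"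
    by blast
  with us(3) assms(3) show ?thesis
    by (intro exI[of _ "us @ ws"]) simp
qed

lemma overhead_pos: "0 < overhead"
  using \<Delta>_pos by (simp add: overhead_def star_count_def)

text \<open>Dropping the nonnegative edge count and deficit from the invariant bounds the length
  alone by the recourse.\<close>

lemma amortized_recourse_ge:
  assumes "invariant ALG n s us" "us \<noteq> []"
  shows "amortized_recourse ALG n us \<ge> 1/2 - real s / (2 * real (length us))"
proof -
  have "length us \<le> 2 * total_recourse ALG n us + s"
    using assms(1) by (simp add: invariant_def)
  then have "real (length us) \<le> 2 * real (total_recourse ALG n us) + real s"
    by linarith
  moreover have "amortized_recourse ALG n us = real (total_recourse ALG n us) / real (length us)"
    by (simp add: amortized_recourse_def total_recourse_def)
  ultimately show ?thesis
    using assms(2) by (simp add: field_simps)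
qed

lemma ex_bad_sequence:
  assumes ALG: "maintains_coloring \<Delta> \<kappa> ALG" and n: "vertex_bound \<le> n" and "\<epsilon> > 0"
  shows "\<exists>us. us \<noteq> [] \<and> update_sequence n \<Delta> us \<and> amortized_recourse ALG n us > 1/2 - \<epsilon> \<and>
    2 * overhead \<le> length us \<and> amortized_recourse ALG n (take (2 * overhead) us) \<ge> 1/4"
proof -
  have "star_count * (\<Delta> - 1) \<le> 2 * overhead"
    by (simp add: overhead_def)
  \<comment> \<open>At this length the error term \<open>overhead / (2 * length us)\<close> is
    exactly \<open>1/4\<close>.\<close>
  then obtain us where us: "length us = 2 * overhead" "invariant ALG n overhead us"
    using ex_sequence_of_length[OF ALG n] by blast
  \<comment> \<open>More than \<open>overhead / \<epsilon>\<close> further updates push the error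
    term below \<open>\<epsilon>\<close>, while \<open>us\<close> remains a prefix.\<close>
  obtain K :: nat where K: "real overhead / \<epsilon> < real K"
    using reals_Archimedean2 by blast
  obtain ws where ws: "length ws = K" "invariant ALG n overhead (us @ ws)"
    using invariant_extend[OF ALG n us(2)] by blast
  have ne: "us \<noteq> []"
    using us(1) overhead_pos by auto
  have "real overhead < \<epsilon> * real K"
    using K \<open>\<epsilon> > 0\<close> by (simp add: field_simps)
  also have "\<dots> \<le> \<epsilon> * (2 * real (length (us @ ws)))"
    using ws(1) \<open>\<epsilon> > 0\<close> by (intro mult_left_mono) auto
  finally have "real overhead / (2 * real (length (us @ ws))) < \<epsilon>"
    using ne by (subst pos_divide_less_eq) (simp_all add: add_pos_nonneg)
  moreover have "amortized_recourse ALG n (us @ ws)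
      \<ge> 1/2 - real overhead / (2 * real (length (us @ ws)))"
    using ne by (intro amortized_recourse_ge[OF ws(2)]) simp
  moreover have "amortized_recourse ALG n us \<ge> 1/4"
    using amortized_recourse_ge[OF us(2) ne] overhead_pos by (simp add: us(1))
  ultimately show ?thesis
    using ws(2) ne us(1) by (intro exI[of _ "us @ ws"]) (auto simp: invariant_def)
qed

end

theorem theorem2p3:
  "\<exists>(a::real) (C::real). a > 0 \<and> C > 0 \<and>
     (\<forall>(\<Delta>::nat) (c::nat) (\<kappa>::nat). \<Delta> \<ge> 3 \<and> c \<in> {0..\<Delta> - 2} \<and> \<kappa> = \<Delta> + c \<longrightarrow>
       (\<exists>n0::nat. \<forall>ALG. maintains_coloring \<Delta> \<kappa> ALG \<longrightarrow>
         (\<forall>n\<ge>n0. \<forall>\<epsilon>::real. \<epsilon> > 0 \<longrightarrow>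
           (\<exists>us. us \<noteq> [] \<and> update_sequence n \<Delta> us \<and>
              amortized_recourse ALG n us > 1/2 - \<epsilon> \<and>
              (\<exists>m. 0 < m \<and> m \<le> length us \<and> real m \<le> C * real n0 \<and>
                   amortized_recourse ALG n (take m us) \<ge> a)))))"
proof (rule exI[of _ "1/4"], rule exI[of _ 1], intro conjI allI impI)
  fix \<Delta> c \<kappa> :: nat
  assume *: "\<Delta> \<ge> 3 \<and> c \<in> {0..\<Delta> - 2} \<and> \<kappa> = \<Delta> + c"
  interpret adversary \<Delta> \<kappa>
    by unfold_locales (use * in auto)
  show "\<exists>n0::nat. \<forall>ALG. maintains_coloring \<Delta> \<kappa> ALG \<longrightarrow>
      (\<forall>n\<ge>n0. \<forall>\<epsilon>::real. \<epsilon> > 0 \<longrightarrow>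
        (\<exists>us. us \<noteq> [] \<and> update_sequence n \<Delta> us \<and>
          amortized_recourse ALG n us > 1/2 - \<epsilon> \<and>
          (\<exists>m. 0 < m \<and> m \<le> length us \<and> real m \<le> 1 * real n0 \<and>
            amortized_recourse ALG n (take m us) \<ge> 1/4)))"
  \<comment> \<open>\<open>vertex_bound\<close> lets hubs and stars fit; \<open>2 * overhead\<close>
    makes the prefix length \<open>m\<close> at most \<open>n0\<close>, so \<open>C = 1\<close>
    works.\<close>
  proof (intro exI[of _ "max vertex_bound (2 * overhead)"] allI impI)
    fix ALG n and \<epsilon> :: real
    assume ALG: "maintains_coloring \<Delta> \<kappa> ALG" and n: "max vertex_bound (2 * overhead) \<le> n"
      and \<epsilon>: "\<epsilon> > 0"
    obtain us where "us \<noteq> [] \<and> update_sequence n \<Delta> us \<and>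
        amortized_recourse ALG n us > 1/2 - \<epsilon> \<and> 2 * overhead \<le> length us \<and>
        amortized_recourse ALG n (take (2 * overhead) us) \<ge> 1/4"
      using ex_bad_sequence[OF ALG _ \<epsilon>] n by auto
    then show "\<exists>us. us \<noteq> [] \<and> update_sequence n \<Delta> us \<and>
        amortized_recourse ALG n us > 1/2 - \<epsilon> \<and>
        (\<exists>m. 0 < m \<and> m \<le> length us \<and> real m \<le> 1 * real (max vertex_bound (2 * overhead)) \<and>
          amortized_recourse ALG n (take m us) \<ge> 1/4)"
      using overhead_pos by (intro exI[of _ us] conjI exI[of _ "2 * overhead"]) auto
  qed
qed auto

end
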